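(* Let $G=(V,E)$ be a finite simple graph and let $B$ be the constraint matrix of the rank inequalities of $G$. Let $g\in\{0,1,-1\}^E$ be a mixed-sign vector and let $S\subseteq E$ be such that each of $S$ and $E\setminus S$ contains at least one edge $e$ with $g(e)=1$ and at least one edge $f$ with $g(f)=-1$. Let $y\in\mathbb{R}^E$ be a vector obtained from $g$ by dropping the edge set $S$, i.e. $\mathrm{supp}(y)=\mathrm{supp}(g)\setminus S$ (the nonzero entries of $y$ may differ from those of $g$), and suppose that $y$ is mixed-sign and $\mathrm{supp}(By)\subsetneq\mathrm{supp}(Bg)$. Then $\mathrm{supp}(g)$ is the disjoint union of two edge sets which each induce a connected graph of diameter at most $5$.
   Context: The rank inequalities of $G=(V,E)$ are $\sum_{e\in E(G[U])}x(e)\le |U|-1$ for all $\emptyset\neq U\subseteq V$, where $G[U]$ is the subgraph induced by $U$. Thus $B$ has columns indexed by $E$, one row for each nonempty $U\subseteq V$, and $(Bx)_U=\sum_{e\in E(G[U])}x(e)$. $\mathrm{supp}$ denotes the set of indices of nonzero entries. A vector is mixed-sign if it has at least one positive and at least one negative entry. Convention: for an edge set $R\subseteq\mathrm{supp}(g)$, the graph induced by $R$ is the induced subgraph, on the set $V(R)$ of endpoints of edges of $R$, of the graph whose edge set is $\mathrm{supp}(g)$; that is, it has vertex set $V(R)$ and all edges of $\mathrm{supp}(g)$ with both endpoints in $V(R)$. *)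

theory Defs
  imports "Graph_Theory.Graph_Theory"
begin

definition finite_simple_graph :: "'a set \<Rightarrow> 'a set set \<Rightarrow> bool" where
  "finite_simple_graph V E \<longleftrightarrow> finite V \<and> (\<forall>e\<in>E. e \<subseteq> V \<and> card e = 2)"

text \<open>Vectors indexed by a set \<open>I\<close> are functions of which only the values on \<open>I\<close> matter.\<close>

definition supp :: "'i set \<Rightarrow> ('i \<Rightarrow> real) \<Rightarrow> 'i set" where
  "supp I x = {i \<in> I. x i \<noteq> 0}"

definition mixed_sign :: "'i set \<Rightarrow> ('i \<Rightarrow> real) \<Rightarrow> bool" where
  "mixed_sign I x \<longleftrightarrow> (\<exists>i\<in>I. x i > 0) \<and> (\<exists>i\<in>I. x i < 0)"

definition mat_vec :: "'c set \<Rightarrow> ('r \<Rightarrow> 'c \<Rightarrow> real) \<Rightarrow> ('c \<Rightarrow> real) \<Rightarrow> 'r \<Rightarrow> real" where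
  "mat_vec C A x r = (\<Sum>c\<in>C. A r c * x c)"

definition induced_edges :: "'a set set \<Rightarrow> 'a set \<Rightarrow> 'a set set" where
  "induced_edges E U = {e \<in> E. e \<subseteq> U}"

definition rank_rows :: "'a set \<Rightarrow> 'a set set" where
  "rank_rows V = {U. U \<noteq> {} \<and> U \<subseteq> V}"

definition rank_matrix :: "'a set set \<Rightarrow> 'a set \<Rightarrow> 'a set \<Rightarrow> real" where
  "rank_matrix E U e = (if e \<in> induced_edges E U then 1 else 0)"

lemma mat_vec_rank_matrix:
  assumes "finite E"
  shows "mat_vec E (rank_matrix E) x U = (\<Sum>e\<in>induced_edges E U. x e)"
proof -
  have "induced_edges E U = {e \<in> E. e \<in> induced_edges E U}"
    by (auto simp: induced_edges_def)
  then have "(\<Sum>e\<in>induced_edges E U. x e) = (\<Sum>e\<in>{e \<in> E. e \<in> induced_edges E U}. x e)"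
    by (rule arg_cong)
  also have "\<dots> = (\<Sum>e\<in>E. if e \<in> induced_edges E U then x e else 0)"
    by (rule sum.inter_filter[OF assms])
  also have "\<dots> = mat_vec E (rank_matrix E) x U"
    unfolding mat_vec_def rank_matrix_def by (rule sum.cong) auto
  finally show ?thesis by simp
qed

text \<open>An undirected graph on \<open>W\<close> with edge set \<open>F\<close> becomes the symmetric digraph that has both
  orientations of every edge.\<close>

definition graph_of :: "'a set \<Rightarrow> 'a set set \<Rightarrow> ('a, 'a \<times> 'a) pre_digraph" where
  "graph_of W F = with_proj \<lparr> pverts = W, parcs = {(u, v). {u, v} \<in> F} \<rparr>"

text \<open>For \<open>R \<subseteq> F\<close> this has all edges of \<open>F\<close> with both endpoints covered by \<open>R\<close>,
  not just the edges in \<open>R\<close>.\<close>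

definition graph_induced_by :: "'a set \<Rightarrow> 'a set set \<Rightarrow> 'a set set \<Rightarrow> ('a, 'a \<times> 'a) pre_digraph" where
  "graph_induced_by V F R = graph_of V F \<restriction> \<Union>R"

text \<open>Distances are counted in edges, and are infinite between different components.\<close>

definition graph_dist :: "('a, 'b) pre_digraph \<Rightarrow> 'a \<Rightarrow> 'a \<Rightarrow> ereal" where
  "graph_dist H u v = wf_digraph.\<mu> H (\<lambda>_. 1) u v"

definition graph_diameter :: "('a, 'b) pre_digraph \<Rightarrow> ereal" where
  "graph_diameter H = (SUP u\<in>verts H. SUP v\<in>verts H. graph_dist H u v)"

end

theory Submission
  imports Defs
begin

text \<open>
  Split \<open>supp E g\<close> by sign and by membership in \<open>S\<close> into four nonempty classes, and pair them
  crosswise: the positive edges in \<open>S\<close> go with the negative edges outside \<open>S\<close>, and the negative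
  edges in \<open>S\<close> with the positive edges outside \<open>S\<close>.

  The point is that in each pair every edge \<open>e\<close> of one class is within distance one of every edge
  \<open>f\<close> of the other. If \<open>e\<close> and \<open>f\<close> were disjoint and no edge of \<open>supp E g\<close> ran between them, the
  set \<open>U = e \<union> f\<close> would span only these two edges of \<open>supp E g\<close>, so row \<open>U\<close> of \<open>B g\<close> would vanish because the signs
  cancel, whereas row \<open>U\<close> of \<open>B y\<close> would be the single nonzero entry of \<open>y\<close> on the edge outside
  \<open>S\<close>. This contradicts \<open>supp (B y) \<subseteq> supp (B g)\<close> (lemma \<open>opposite_edges_linked\<close>).

  A vertex of \<open>e\<close> thus reaches any vertex of \<open>f\<close> in at most three steps, and two vertices on edges
  \<open>e, e'\<close> of the same class are joined through an arbitrary edge \<open>f\<close> of the other class in at most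
  five: inside \<open>e\<close>, over to \<open>f\<close>, inside \<open>f\<close>, over to \<open>e'\<close>, inside \<open>e'\<close>
  (lemma \<open>completely_linked_diameter\<close>).
\<close>

text \<open>Staying put counts as a step, so that the relational power \<open>lazy_steps F W ^^ n\<close> relates
  vertices of \<open>W\<close> that a walk inside \<open>W\<close> joins with at most \<open>n\<close> edges, not exactly \<open>n\<close>.\<close>

definition lazy_steps :: "'a set set \<Rightarrow> 'a set \<Rightarrow> ('a \<times> 'a) set" where
  "lazy_steps F W = {(u, v). u \<in> W \<and> v \<in> W \<and> (u = v \<or> {u, v} \<in> F)}"

definition linked :: "'a set set \<Rightarrow> 'a set \<Rightarrow> 'a set \<Rightarrow> bool" where
  "linked F e f \<longleftrightarrow> (\<exists>a\<in>e. \<exists>b\<in>f. a = b \<or> {a, b} \<in> F)"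

lemma linked_sym: "linked F e f \<Longrightarrow> linked F f e"
  unfolding linked_def by (metis insert_commute)

lemma verts_graph_induced_by: "verts (graph_induced_by V F R) = \<Union>R"
  by (simp add: graph_induced_by_def)

lemma wf_graph_induced_by: "wf_digraph (graph_induced_by V F R)"
  by unfold_locales (auto simp: graph_induced_by_def graph_of_def)

lemma lazy_steps_imp_awalk:
  assumes "(u, v) \<in> lazy_steps F (\<Union>R) ^^ n" and "u \<in> \<Union>R"
  shows "\<exists>p. pre_digraph.awalk (graph_induced_by V F R) u p v \<and> length p \<le> n"
  using assms
proof (induction n arbitrary: v)
  let ?H = "graph_induced_by V F R"
  interpret H: wf_digraph ?H by (rule wf_graph_induced_by)
  case 0
  then show ?case
    by (auto simp: H.awalk_Nil_iff verts_graph_induced_by)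
next
  let ?H = "graph_induced_by V F R"
  interpret H: wf_digraph ?H by (rule wf_graph_induced_by)
  case (Suc n)
  from Suc.prems(1) obtain w where w: "(u, w) \<in> lazy_steps F (\<Union>R) ^^ n"
    and step: "(w, v) \<in> lazy_steps F (\<Union>R)"
    by auto
  from Suc.IH[OF w Suc.prems(2)] obtain p where p: "H.awalk u p w" "length p \<le> n"
    by blast
  show ?case
  proof (cases "w = v")
    case True
    with p show ?thesis by (auto intro: le_SucI)
  next
    case False
    with step have "H.awalk w [(w, v)] v"
      by (auto simp: lazy_steps_def H.awalk_simps verts_graph_induced_by)
        (auto simp: graph_induced_by_def graph_of_def)
    with p(1) have "H.awalk u (p @ [(w, v)]) v"
      by (rule H.awalk_appendI)
    with p(2) show ?thesis
      by (intro exI[of _ "p @ [(w, v)]"]) simp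
  qed
qed

lemma connected_diameter_if_lazy_steps:
  assumes ne: "\<Union>R \<noteq> {}"
    and steps: "\<And>u v. u \<in> \<Union>R \<Longrightarrow> v \<in> \<Union>R \<Longrightarrow> (u, v) \<in> lazy_steps F (\<Union>R) ^^ n"
  shows "Digraph_Component.connected (graph_induced_by V F R)"
    and "graph_diameter (graph_induced_by V F R) \<le> real n"
proof -
  let ?H = "graph_induced_by V F R"
  interpret H: wf_digraph ?H by (rule wf_graph_induced_by)
  have walk: "\<exists>p. H.awalk u p v \<and> length p \<le> n" if "u \<in> \<Union>R" "v \<in> \<Union>R" for u v
    using lazy_steps_imp_awalk[OF steps[OF that] that(1)] .
  have "strongly_connected (mk_symmetric ?H)"
  proof (rule strongly_connectedI)
    show "verts (mk_symmetric ?H) \<noteq> {}"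
      using ne by (simp add: verts_graph_induced_by)
    fix u v
    assume "u \<in> verts (mk_symmetric ?H)" "v \<in> verts (mk_symmetric ?H)"
    then have "u \<rightarrow>\<^sup>*\<^bsub>?H\<^esub> v"
      using walk[of u v] by (auto simp: verts_graph_induced_by H.reachable_awalk)
    then show "u \<rightarrow>\<^sup>*\<^bsub>mk_symmetric ?H\<^esub> v"
      by (rule H.reachable_mk_symmetricI)
  qed
  then show "Digraph_Component.connected ?H"
    by (simp add: Digraph_Component.connected_def)
  have "graph_dist ?H u v \<le> real n" if uv: "u \<in> \<Union>R" "v \<in> \<Union>R" for u v
  proof -
    from walk[OF uv] obtain p where p: "H.awalk u p v" "length p \<le> n" by blast
    have "H.awalk_cost (\<lambda>_. 1) p = real (length p)"
      by (induction p) simp_all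
    with H.min_cost_le_walk_cost[OF p(1), of "\<lambda>_. 1"] p(2) show ?thesis
      unfolding graph_dist_def by (metis ereal_less_eq(3) of_nat_le_iff order_trans)
  qed
  then show "graph_diameter ?H \<le> real n"
    unfolding graph_diameter_def by (auto intro!: SUP_least simp: verts_graph_induced_by)
qed

text \<open>The longest route runs between two edges of the same class, through any edge of the other
  class: three steps inside edges and two along links.\<close>

lemma completely_linked_diameter:
  assumes edges: "A \<union> B \<subseteq> F" "\<And>e. e \<in> F \<Longrightarrow> card e = 2"
    and ne: "A \<noteq> {}" "B \<noteq> {}"
    and link: "\<And>e f. e \<in> A \<Longrightarrow> f \<in> B \<Longrightarrow> linked F e f"
  shows "Digraph_Component.connected (graph_induced_by V F (A \<union> B)) \<and>
    graph_diameter (graph_induced_by V F (A \<union> B)) \<le> 5"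
proof -
  define W where "W = \<Union>(A \<union> B)"
  let ?T = "lazy_steps F W"
  have inside: "(u, v) \<in> ?T" if "u \<in> e" "v \<in> e" "e \<in> A \<union> B" for u v e
  proof -
    have "card e = 2" using that edges by blast
    then have "u = v \<or> e = {u, v}" using that by (auto simp: card_2_iff)
    then show ?thesis using that edges unfolding lazy_steps_def W_def by blast
  qed
  have across: "(u, v) \<in> ?T ^^ 3"
    if ef: "linked F e f" and "e \<in> A \<union> B" "f \<in> A \<union> B" "u \<in> e" "v \<in> f" for u v e f
  proof -
    obtain a b where ab: "a \<in> e" "b \<in> f" "a = b \<or> {a, b} \<in> F"
      using ef by (auto simp: linked_def)
    then have "(a, b) \<in> ?T" using that unfolding lazy_steps_def W_def by blast
    moreover have "(u, a) \<in> ?T" "(b, v) \<in> ?T" using inside ab that by blast+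
    ultimately show ?thesis by (auto simp: numeral_3_eq_3)
  qed
  have steps: "(u, v) \<in> ?T ^^ 5" if uv: "u \<in> W" "v \<in> W" for u v
  proof -
    obtain e e' where e: "e \<in> A \<union> B" "u \<in> e" and e': "e' \<in> A \<union> B" "v \<in> e'"
      using uv by (auto simp: W_def)
    show ?thesis
    proof (cases "linked F e e'")
      case True
      have "(u, v) \<in> ?T ^^ 3" using across[OF True] e e' by blast
      moreover have "(v, v) \<in> ?T" using uv(2) by (simp add: lazy_steps_def)
      ultimately show ?thesis by (auto simp: eval_nat_numeral)
    next
      case False
      then have "e \<in> A \<and> e' \<in> A \<or> e \<in> B \<and> e' \<in> B"
        using e e' link linked_sym by blast
      then obtain f where f: "f \<in> A \<union> B" "linked F e f" "linked F f e'"
        using ne link linked_sym by blast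
      obtain a b where ab: "a \<in> f" "b \<in> e'" "a = b \<or> {a, b} \<in> F"
        using f(3) by (auto simp: linked_def)
      have "(u, a) \<in> ?T ^^ 3" using across[OF f(2) e(1) f(1) e(2) ab(1)] .
      moreover have "(a, b) \<in> ?T"
        using ab f e' unfolding lazy_steps_def W_def by blast
      moreover have "(b, v) \<in> ?T" using inside ab e' by blast
      ultimately show ?thesis by (auto simp: eval_nat_numeral)
    qed
  qed
  have "W \<noteq> {}"
  proof -
    obtain e where "e \<in> A" using ne by blast
    moreover have "card e = 2" using edges \<open>e \<in> A\<close> by blast
    then have "e \<noteq> {}" by auto
    ultimately show ?thesis unfolding W_def by blast
  qed
  with connected_diameter_if_lazy_steps[where R = "A \<union> B" and F = F and n = 5 and V = V] steps show ?thesis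
    unfolding W_def by auto
qed

text \<open>Without a link, \<open>e \<union> f\<close> spans no further edge of \<open>supp E g\<close>: the row of \<open>e \<union> f\<close> then
  evaluates to \<open>g e + g f = 0\<close> on \<open>g\<close>, but to \<open>y f \<noteq> 0\<close> on \<open>y\<close>.\<close>

lemma opposite_edges_linked:
  assumes graph: "finite_simple_graph V E"
    and e: "e \<in> E" "g e \<noteq> 0" and f: "f \<in> E" and opposite: "g e + g f = 0"
    and y: "y e = 0" "y f \<noteq> 0" and supp_y: "supp E y \<subseteq> supp E g"
    and rows: "supp (rank_rows V) (mat_vec E (rank_matrix E) y)
      \<subseteq> supp (rank_rows V) (mat_vec E (rank_matrix E) g)"
  shows "linked (supp E g) e f"
proof (rule ccontr)
  assume unlinked: "\<not> linked (supp E g) e f"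
  let ?U = "e \<union> f"
  have card2: "card d = 2" "d \<subseteq> V" if "d \<in> E" for d
    using graph that by (auto simp: finite_simple_graph_def)
  have "E \<subseteq> Pow V" using card2 by blast
  moreover have "finite V" using graph by (simp add: finite_simple_graph_def)
  ultimately have "finite E" by (meson finite_Pow_iff finite_subset)
  have U: "?U \<in> rank_rows V"
    using card2[OF e(1)] card2[OF f] by (auto simp: rank_rows_def)
  have "e \<noteq> f" using y by auto
  \<comment> \<open>An edge with one end in each of \<open>e\<close> and \<open>f\<close> would be a link, so an edge inside \<open>e \<union> f\<close>
    lies in \<open>e\<close> or in \<open>f\<close>, and then it is \<open>e\<close> or \<open>f\<close>.\<close>
  have spanned: "d = e \<or> d = f" if d: "d \<in> supp E g" "d \<subseteq> ?U" for d
  proof -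
    have "d \<in> E" using d by (simp add: supp_def)
    then obtain a b where ab: "d = {a, b}" "a \<noteq> b"
      using card2 by (meson card_2_iff)
    have "\<not> (a \<in> e \<and> b \<in> f)" "\<not> (b \<in> e \<and> a \<in> f)"
      using unlinked d ab unfolding linked_def by (metis insert_commute)+
    then have "d \<subseteq> e \<or> d \<subseteq> f" using d ab by auto
    moreover have "d = c" if "d \<subseteq> c" "c \<in> E" for c
      using that card2[OF that(2)] card2[OF \<open>d \<in> E\<close>]
      by (metis card_subset_eq card.infinite zero_neq_numeral)
    ultimately show ?thesis using e f by blast
  qed
  have row: "mat_vec E (rank_matrix E) x ?U = x e + x f" if x: "supp E x \<subseteq> supp E g" for x
  proof -
    have "(\<Sum>d\<in>induced_edges E ?U. x d) = (\<Sum>d\<in>{e, f}. x d)"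
    proof (rule sum.mono_neutral_right)
      show "finite (induced_edges E ?U)"
        using \<open>finite E\<close> by (simp add: induced_edges_def)
      show "{e, f} \<subseteq> induced_edges E ?U"
        using e f by (auto simp: induced_edges_def)
      show "\<forall>d\<in>induced_edges E ?U - {e, f}. x d = 0"
        using spanned x by (fastforce simp: induced_edges_def supp_def)
    qed
    with \<open>e \<noteq> f\<close> \<open>finite E\<close> show ?thesis by (simp add: mat_vec_rank_matrix)
  qed
  have "?U \<in> supp (rank_rows V) (mat_vec E (rank_matrix E) y)"
    using U y row[OF supp_y] by (simp add: supp_def)
  moreover have "?U \<notin> supp (rank_rows V) (mat_vec E (rank_matrix E) g)"
    using row[OF order_refl] opposite by (simp add: supp_def)
  ultimately show False using rows by blast
qed

theorem theorem4p11:
  fixes V :: "'a set" and E :: "'a set set"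
    and g y :: "'a set \<Rightarrow> real" and S :: "'a set set"
  assumes "finite_simple_graph V E"
    and "\<forall>e\<in>E. g e \<in> {0, 1, -1}"
    and "mixed_sign E g"
    and "S \<subseteq> E"
    and "\<exists>e\<in>S. g e = 1" and "\<exists>f\<in>S. g f = -1"
    and "\<exists>e\<in>E - S. g e = 1" and "\<exists>f\<in>E - S. g f = -1"
    and "supp E y = supp E g - S"
    and "mixed_sign E y"
    and "supp (rank_rows V) (mat_vec E (rank_matrix E) y)
         \<subset> supp (rank_rows V) (mat_vec E (rank_matrix E) g)"
  shows "\<exists>R1 R2. supp E g = R1 \<union> R2 \<and> R1 \<inter> R2 = {} \<and>
           (\<forall>R\<in>{R1, R2}.
              Digraph_Component.connected (graph_induced_by V (supp E g) R) \<and>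
              graph_diameter (graph_induced_by V (supp E g) R) \<le> 5)"
proof -
  define A where "A s = {e \<in> S. g e = s}" for s
  define B where "B s = {e \<in> E - S. g e = s}" for s
  have good: "Digraph_Component.connected (graph_induced_by V (supp E g) (A s \<union> B (- s))) \<and>
      graph_diameter (graph_induced_by V (supp E g) (A s \<union> B (- s))) \<le> 5"
    if s: "s \<in> {1, -1}" for s
  proof (rule completely_linked_diameter)
    show "A s \<union> B (- s) \<subseteq> supp E g"
      using s assms(4) by (auto simp: A_def B_def supp_def)
    show "card e = 2" if "e \<in> supp E g" for e
      using that assms(1) by (auto simp: supp_def finite_simple_graph_def)
    show "A s \<noteq> {}" "B (- s) \<noteq> {}"
      using s assms(5-8) by (auto simp: A_def B_def)
    show "linked (supp E g) e f" if "e \<in> A s" "f \<in> B (- s)" for e f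
    proof (rule opposite_edges_linked[OF assms(1)])
      show "e \<in> E" "g e \<noteq> 0" "f \<in> E" "g e + g f = 0"
        using that s assms(4) by (auto simp: A_def B_def)
      show "y e = 0"
        using that assms(4,9) by (auto simp: A_def supp_def)
      have "f \<in> supp E g - S"
        using that s by (auto simp: B_def supp_def)
      then have "f \<in> supp E y" using assms(9) by simp
      then show "y f \<noteq> 0" by (simp add: supp_def)
      show "supp E y \<subseteq> supp E g" using assms(9) by blast
      show "supp (rank_rows V) (mat_vec E (rank_matrix E) y)
          \<subseteq> supp (rank_rows V) (mat_vec E (rank_matrix E) g)"
        using assms(11) by blast
    qed
  qed
  \<comment> \<open>The signs \<open>s = 1\<close> and \<open>s = -1\<close> give the two crosswise pairs.\<close>
  have "supp E g = (A 1 \<union> B (-1)) \<union> (A (-1) \<union> B 1)"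
    using assms(2,4) by (auto simp: A_def B_def supp_def)
  moreover have "(A 1 \<union> B (-1)) \<inter> (A (-1) \<union> B 1) = {}"
    by (auto simp: A_def B_def)
  ultimately show ?thesis
    using good[of 1] good[of "-1"]
    by (intro exI[of _ "A 1 \<union> B (-1)"] exI[of _ "A (-1) \<union> B 1"]) simp
qed

end
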